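(* Let $\mathbb F$ be a field of characteristic $2$, let $(L,[\cdot,\cdot],(\cdot)^{[2]})$ be a restricted Lie algebra over $\mathbb F$ and let $M$ be a restricted $L$-module. Then $\left(C^n_{*_2}(L,M),d^n_{*_2}\right)_{n\ge0}$ is a cochain complex, i.e. each $d^n_{*_2}$ is a well-defined map $C^n_{*_2}(L,M)\to C^{n+1}_{*_2}(L,M)$ and $d^{n+1}_{*_2}\circ d^n_{*_2}=0$ for all $n\ge0$. (Hence the $n$-th restricted cohomology group $H^n_{*_2}(L,M)=\ker(d^n_{*_2})/\mathrm{Im}(d^{n-1}_{*_2})$ is defined for all $n$.)
   Context: A restricted Lie algebra in characteristic $2$ is a Lie algebra $L$ (with $[x,x]=0$) with a map $(\cdot)^{[2]}:L\to L$ such that $(\lambda x)^{[2]}=\lambda^2x^{[2]}$, $[x,y^{[2]}]=[[x,y],y]$, $(x+y)^{[2]}=x^{[2]}+y^{[2]}+[x,y]$. A restricted $L$-module is an $L$-module $M$ with $x^{[2]}\cdot m=x\cdot(x\cdot m)$. $C^n_{CE}(L,M)$ is the space of alternating $n$-linear maps $L^n\to M$ ($C^0_{CE}(L,M)=M$), and (characteristic $2$, so no signs) $d^n_{CE}\varphi(x_1,\dots,x_{n+1})=\sum_{i<j}\varphi([x_i,x_j],x_1,\dots,\hat x_i,\dots,\hat x_j,\dots,x_{n+1})+\sum_i x_i\cdot\varphi(x_1,\dots,\hat x_i,\dots,x_{n+1})$. Cochains: $C^0_{*_2}(L,M)=M$, $C^1_{*_2}(L,M)=\mathrm{Hom}_{\mathbb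 F}(L,M)$. For $n\ge2$, $C^n_{*_2}(L,M)$ is the set of pairs $(\varphi,\omega)$ with $\varphi\in C^n_{CE}(L,M)$ and $\omega:L\times\wedge^{n-2}L\to M$ (a map $\omega(x,z_2,\dots,z_{n-1})$, multilinear and alternating in $z_2,\dots,z_{n-1}$) such that $\omega(\lambda x,z_2,\dots,z_{n-1})=\lambda^2\omega(x,z_2,\dots,z_{n-1})$ and $\omega(x+y,z_2,\dots,z_{n-1})=\omega(x,z_2,\dots,z_{n-1})+\omega(y,z_2,\dots,z_{n-1})+\varphi(x,y,z_2,\dots,z_{n-1})$. Differentials: $d^0_{*_2}=d^0_{CE}$, i.e. $d^0_{*_2}m(x)=x\cdot m$; $d^1_{*_2}\varphi=(d^1_{CE}\varphi,\omega)$ with $\omega(x)=\varphi(x^{[2]})+x\cdot\varphi(x)$; for $n\ge2$, $d^n_{*_2}(\varphi,\omega)=(d^n_{CE}\varphi,\delta^n\omega)$ with $$\delta^n\omega(x,z_2,\dots,z_n)=x\cdot\varphi(x,z_2,\dots,z_n)+\sum_{i=2}^nz_i\cdot\omega(x,z_2,\dots,\hat z_i,\dots,z_n)+\varphi(x^{[2]},z_2,\dots,z_n)+\sum_{i=2}^n\varphi([x,z_i],x,z_2,\dots,\hat z_i,\dots,z_n)+\sum_{2\le i<j\le n}\omega(x,[z_i,z_j],z_2,\dots,\hat z_i,\dots,\hat z_j,\dots,z_n).$$ *)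

theory Defs
  imports
    "HOL-Computational_Algebra.Computational_Algebra"
    "HOL-Library.Function_Algebras"
    "HOL-Library.Product_Plus"
begin

locale lie_algebra = vector_space scaleL
  for scaleL :: "'f::field \<Rightarrow> 'l::ab_group_add \<Rightarrow> 'l" +
  fixes bracket :: "'l \<Rightarrow> 'l \<Rightarrow> 'l"
  assumes bracket_linear_left: "\<And>y. Vector_Spaces.linear scaleL scaleL (\<lambda>x. bracket x y)"
    and bracket_linear_right: "\<And>x. Vector_Spaces.linear scaleL scaleL (bracket x)"
    and bracket_self: "\<And>x. bracket x x = 0"
    and jacobi:
      "\<And>x y z. bracket x (bracket y z) + bracket y (bracket z x) + bracket z (bracket x y) = 0"

locale lie_module = lie_algebra scaleL bracket + M: vector_space scaleM
  for scaleL :: "'f::field \<Rightarrow> 'l::ab_group_add \<Rightarrow> 'l"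
    and bracket :: "'l \<Rightarrow> 'l \<Rightarrow> 'l"
    and scaleM :: "'f \<Rightarrow> 'm::ab_group_add \<Rightarrow> 'm" +
  fixes act :: "'l \<Rightarrow> 'm \<Rightarrow> 'm"
  assumes act_linear_left: "\<And>m. Vector_Spaces.linear scaleL scaleM (\<lambda>x. act x m)"
    and act_linear_right: "\<And>x. Vector_Spaces.linear scaleM scaleM (act x)"
    and act_bracket: "\<And>x y m. act (bracket x y) m = act x (act y m) - act y (act x m)"

locale restricted_lie_algebra_char2 = lie_algebra scaleL bracket
  for scaleL :: "'f::field \<Rightarrow> 'l::ab_group_add \<Rightarrow> 'l"
    and bracket :: "'l \<Rightarrow> 'l \<Rightarrow> 'l" +
  fixes sq :: "'l \<Rightarrow> 'l"
  assumes char_2: "CHAR('f) = 2"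
    and sq_scale: "\<And>a x. sq (scaleL a x) = scaleL (a\<^sup>2) (sq x)"
    and bracket_sq: "\<And>x y. bracket x (sq y) = bracket (bracket x y) y"
    and sq_add: "\<And>x y. sq (x + y) = sq x + sq y + bracket x y"

locale restricted_module_char2 =
  restricted_lie_algebra_char2 scaleL bracket sq + lie_module scaleL bracket scaleM act
  for scaleL :: "'f::field \<Rightarrow> 'l::ab_group_add \<Rightarrow> 'l"
    and bracket :: "'l \<Rightarrow> 'l \<Rightarrow> 'l"
    and sq :: "'l \<Rightarrow> 'l"
    and scaleM :: "'f \<Rightarrow> 'm::ab_group_add \<Rightarrow> 'm"
    and act :: "'l \<Rightarrow> 'm \<Rightarrow> 'm" +
  assumes act_sq: "\<And>x m. act (sq x) m = act x (act x m)"


text \<open>A map $L^n \to M$ is encoded as a function on lists that is set to \<open>0\<close> on all lists of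
  length other than \<open>n\<close>, so that equality of functions is equality of maps on $L^n$.
  List positions are counted from \<open>0\<close>.\<close>

definition CE_cochains ::
    "('f::field \<Rightarrow> 'l::ab_group_add \<Rightarrow> 'l) \<Rightarrow> ('f \<Rightarrow> 'm::ab_group_add \<Rightarrow> 'm) \<Rightarrow> nat \<Rightarrow> ('l list \<Rightarrow> 'm) set"
  where "CE_cochains scaleL scaleM n = {\<phi>.
    (\<forall>xs. length xs \<noteq> n \<longrightarrow> \<phi> xs = 0) \<and>
    (\<forall>xs i. length xs = n \<longrightarrow> i < n \<longrightarrow> Vector_Spaces.linear scaleL scaleM (\<lambda>x. \<phi> (xs[i := x]))) \<and>
    (\<forall>xs i j. length xs = n \<longrightarrow> i < j \<longrightarrow> j < n \<longrightarrow> xs ! i = xs ! j \<longrightarrow> \<phi> xs = 0)}"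

text \<open>\<open>nths xs (- I)\<close> is the list \<open>xs\<close> with the entries at the positions in \<open>I\<close> omitted.
  The signs of the usual formula are dropped, as only characteristic 2 is considered.\<close>

definition CE_diff ::
    "('l \<Rightarrow> 'l \<Rightarrow> 'l) \<Rightarrow> ('l \<Rightarrow> 'm \<Rightarrow> 'm) \<Rightarrow> nat \<Rightarrow> ('l list \<Rightarrow> 'm::ab_group_add) \<Rightarrow> 'l list \<Rightarrow> 'm"
  where "CE_diff bracket act n \<phi> xs =
    (if length xs = Suc n then
       (\<Sum>j<Suc n. \<Sum>i<j. \<phi> (bracket (xs ! i) (xs ! j) # nths xs (- {i, j}))) +
       (\<Sum>i<Suc n. act (xs ! i) (\<phi> (nths xs (- {i}))))
     else 0)"


text \<open>All cochain spaces live in one type of pairs \<open>(\<phi>, \<omega>)\<close>, where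
  \<open>\<omega> x [z\<^sub>2, \<dots>, z\<^sub>n\<^sub>-\<^sub>1]\<close> stands for $\omega(x, z_2, \dots, z_{n-1})$. In degrees 0 and 1 there
  is no second component; it is set to \<open>0\<close> there.\<close>

type_synonym ('l, 'm) cochain = "('l list \<Rightarrow> 'm) \<times> ('l \<Rightarrow> 'l list \<Rightarrow> 'm)"

definition star2_cochains ::
    "('f::field \<Rightarrow> 'l::ab_group_add \<Rightarrow> 'l) \<Rightarrow> ('f \<Rightarrow> 'm::ab_group_add \<Rightarrow> 'm) \<Rightarrow> nat \<Rightarrow> ('l, 'm) cochain set"
  where "star2_cochains scaleL scaleM n =
    (if n < 2 then CE_cochains scaleL scaleM n \<times> {0}
     else {(\<phi>, \<omega>). \<phi> \<in> CE_cochains scaleL scaleM n \<and>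
       (\<forall>x. \<omega> x \<in> CE_cochains scaleL scaleM (n - 2)) \<and>
       (\<forall>a x zs. length zs = n - 2 \<longrightarrow> \<omega> (scaleL a x) zs = scaleM (a\<^sup>2) (\<omega> x zs)) \<and>
       (\<forall>x y zs. length zs = n - 2 \<longrightarrow> \<omega> (x + y) zs = \<omega> x zs + \<omega> y zs + \<phi> (x # y # zs))})"

definition star2_delta ::
    "('l \<Rightarrow> 'l \<Rightarrow> 'l) \<Rightarrow> ('l \<Rightarrow> 'l) \<Rightarrow> ('l \<Rightarrow> 'm \<Rightarrow> 'm) \<Rightarrow> nat \<Rightarrow>
      ('l, 'm::ab_group_add) cochain \<Rightarrow> 'l \<Rightarrow> 'l list \<Rightarrow> 'm"
  where "star2_delta bracket sq act n = (\<lambda>(\<phi>, \<omega>) x zs.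
    (if length zs = n - 1 then
       act x (\<phi> (x # zs)) +
       (\<Sum>i<n - 1. act (zs ! i) (\<omega> x (nths zs (- {i})))) +
       \<phi> (sq x # zs) +
       (\<Sum>i<n - 1. \<phi> (bracket x (zs ! i) # x # nths zs (- {i}))) +
       (\<Sum>j<n - 1. \<Sum>i<j. \<omega> x (bracket (zs ! i) (zs ! j) # nths zs (- {i, j})))
     else 0))"

definition star2_diff ::
    "('l \<Rightarrow> 'l \<Rightarrow> 'l) \<Rightarrow> ('l \<Rightarrow> 'l) \<Rightarrow> ('l \<Rightarrow> 'm \<Rightarrow> 'm) \<Rightarrow> nat \<Rightarrow>
      ('l, 'm::ab_group_add) cochain \<Rightarrow> ('l, 'm) cochain"
  where "star2_diff bracket sq act n c =
    (CE_diff bracket act n (fst c),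
     if n = 0 then 0
     else if n = 1 then (\<lambda>x zs. if zs = [] then fst c [sq x] + act x (fst c [x]) else 0)
     else star2_delta bracket sq act n c)"

definition cochain_scale ::
    "('f \<Rightarrow> 'm \<Rightarrow> 'm) \<Rightarrow> 'f \<Rightarrow> ('l, 'm) cochain \<Rightarrow> ('l, 'm) cochain"
  where "cochain_scale scaleM a c =
    ((\<lambda>xs. scaleM a (fst c xs)), (\<lambda>x zs. scaleM a (snd c x zs)))"

definition star2_cocycles ::
    "('f::field \<Rightarrow> 'l::ab_group_add \<Rightarrow> 'l) \<Rightarrow> ('l \<Rightarrow> 'l \<Rightarrow> 'l) \<Rightarrow> ('l \<Rightarrow> 'l) \<Rightarrow>
      ('f \<Rightarrow> 'm::ab_group_add \<Rightarrow> 'm) \<Rightarrow> ('l \<Rightarrow> 'm \<Rightarrow> 'm) \<Rightarrow> nat \<Rightarrow> ('l, 'm) cochain set"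
  where "star2_cocycles scaleL bracket sq scaleM act n =
    {c \<in> star2_cochains scaleL scaleM n. star2_diff bracket sq act n c = 0}"

definition star2_coboundaries ::
    "('f::field \<Rightarrow> 'l::ab_group_add \<Rightarrow> 'l) \<Rightarrow> ('l \<Rightarrow> 'l \<Rightarrow> 'l) \<Rightarrow> ('l \<Rightarrow> 'l) \<Rightarrow>
      ('f \<Rightarrow> 'm::ab_group_add \<Rightarrow> 'm) \<Rightarrow> ('l \<Rightarrow> 'm \<Rightarrow> 'm) \<Rightarrow> nat \<Rightarrow> ('l, 'm) cochain set"
  where "star2_coboundaries scaleL bracket sq scaleM act n =
    (if n = 0 then {0}
     else star2_diff bracket sq act (n - 1) ` star2_cochains scaleL scaleM (n - 1))"


lemma vector_space_cochain_scale:
  fixes scaleM :: "'f::field \<Rightarrow> 'm::ab_group_add \<Rightarrow> 'm"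
  assumes "vector_space scaleM"
  shows "vector_space (cochain_scale scaleM :: 'f \<Rightarrow> ('l, 'm) cochain \<Rightarrow> ('l, 'm) cochain)"
proof -
  interpret vector_space scaleM by fact
  show ?thesis
    by (rule vector_space.intro)
      (auto simp: cochain_scale_def prod_eq_iff fun_eq_iff scale_right_distrib scale_left_distrib)
qed

text \<open>The identifications $C^0 = M$ and $C^1 = \mathrm{Hom}(L, M)$.\<close>

lemma star2_cochains_0:
  "bij_betw (\<lambda>m. (\<lambda>xs. if xs = [] then m else 0, 0)) UNIV (star2_cochains scaleL scaleM 0)"
  by (rule bij_betw_byWitness[where f' = "\<lambda>c. fst c []"])
    (auto simp: star2_cochains_def CE_cochains_def fun_eq_iff)

lemma star2_cochains_1:
  "bij_betw (\<lambda>f. (\<lambda>xs. case xs of [x] \<Rightarrow> f x | _ \<Rightarrow> 0, 0))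
     {f. Vector_Spaces.linear scaleL scaleM f} (star2_cochains scaleL scaleM 1)"
proof (rule bij_betw_byWitness[where f' = "\<lambda>c x. fst c [x]"], goal_cases)
  case 2
  show ?case
    by (auto simp: star2_cochains_def CE_cochains_def fun_eq_iff split: list.split)
next
  case 3
  show ?case
    by (auto simp: star2_cochains_def CE_cochains_def length_Suc_conv split: list.split)
next
  case 4
  show ?case
  proof (intro image_subsetI CollectI)
    fix c assume "c \<in> star2_cochains scaleL scaleM 1"
    then have "\<forall>xs i. length xs = 1 \<longrightarrow> i < 1 \<longrightarrow>
        Vector_Spaces.linear scaleL scaleM (\<lambda>x. fst c (xs[i := x]))"
      by (auto simp: star2_cochains_def CE_cochains_def)
    from this[rule_format, of "[0]" 0]
    show "Vector_Spaces.linear scaleL scaleM (\<lambda>x. fst c [x])" by simp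
  qed
qed auto

end

(* In characteristic 2, on alternating cochains, the Chevalley-Eilenberg differential d is determined by
   Cartan's formula i_x d = th_x + d i_x, where i_x inserts x as first argument and th_x is the Lie derivative.
   Taking this as a recursive definition, [th_x, d] = 0 and d d = 0 follow by induction on the
   argument list, from [th_x, i_y] = i_[x,y] and [th_x, th_y] = th_[x,y]. The second
   component of the restricted differential is
     delta(phi, om)(x) = th_x i_x phi + i_(x^[2]) phi + d (om x),
   and applying it twice leaves th_x th_x phi + th_(x^[2]) phi plus terms that occur twice; the
   former vanishes because th_x th_x = th_(x^[2]). *)

theory Submission
  imports Defs
begin

section \<open>Linear maps and lists with omitted entries\<close>

lemma linear_add_scale:
  assumes "Vector_Spaces.linear s1 s2 f"
  shows "f (x + y) = f x + f y" "f (s1 a x) = s2 a (f x)" "f 0 = 0"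
proof -
  interpret Vector_Spaces.linear s1 s2 f by fact
  show "f (x + y) = f x + f y" "f (s1 a x) = s2 a (f x)" "f 0 = 0"
    by (rule add scale zero)+
qed

text \<open>Used to match the explicit sums with recursions on the list: each omission either hits
  the head or passes to the tail. The double sums run over \<open>i < j\<close>, so in a pair only
  the first position can be 0.\<close>

lemma nths_Cons_omit:
  "nths (z # zs) (- {0}) = zs"
  "nths (z # zs) (- {Suc i}) = z # nths zs (- {i})"
  "nths (z # zs) (- {0, Suc j}) = nths zs (- {j})"
  "nths (z # zs) (- {Suc i, Suc j}) = z # nths zs (- {i, j})"
proof -
  have "{k. Suc k \<in> - {0}} = UNIV" "{k. Suc k \<in> - {Suc i}} = - {i}"
    "{k. Suc k \<in> - {0, Suc j}} = - {j}" "{k. Suc k \<in> - {Suc i, Suc j}} = - {i, j}"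
    by auto
  then show "nths (z # zs) (- {0}) = zs"
    "nths (z # zs) (- {Suc i}) = z # nths zs (- {i})"
    "nths (z # zs) (- {0, Suc j}) = nths zs (- {j})"
    "nths (z # zs) (- {Suc i, Suc j}) = z # nths zs (- {i, j})"
    by (simp_all only: nths_Cons) (simp_all add: nths_all)
qed

section \<open>Contraction, Lie derivative and Cartan's differential on arbitrary functions on
  lists\<close>

context lie_module
begin

lemmas bracket_add_left = linear_add_scale(1)[OF bracket_linear_left]
  and bracket_scale_left = linear_add_scale(2)[OF bracket_linear_left]
  and bracket_add_right = linear_add_scale(1)[OF bracket_linear_right]
  and bracket_scale_right = linear_add_scale(2)[OF bracket_linear_right]
  and act_add_left = linear_add_scale(1)[OF act_linear_left]
  and act_scale_left = linear_add_scale(2)[OF act_linear_left]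
  and act_add_right = linear_add_scale(1)[OF act_linear_right]
  and act_scale_right = linear_add_scale(2)[OF act_linear_right]
  and act_zero_right = linear_add_scale(3)[OF act_linear_right]

lemma linear_iff_add_scale:
  "Vector_Spaces.linear scaleL scaleM f \<longleftrightarrow>
    (\<forall>x y. f (x + y) = f x + f y) \<and> (\<forall>a x. f (scaleL a x) = scaleM a (f x))"
  by (simp add: Vector_Spaces.linear_iff vector_space_axioms M.vector_space_axioms)

definition contract :: "'l \<Rightarrow> ('l list \<Rightarrow> 'm) \<Rightarrow> 'l list \<Rightarrow> 'm"
  where "contract x \<phi> = (\<lambda>xs. \<phi> (x # xs))"

text \<open>The relation \<open>[th_x, i_z] = i_[x,z]\<close> read as a recursion. Unfolded,
  \<open>bracket x z\<close> replaces \<open>z\<close> in its place; the usual minus sign of these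
  terms is dropped.\<close>

primrec lie_deriv :: "'l \<Rightarrow> ('l list \<Rightarrow> 'm) \<Rightarrow> 'l list \<Rightarrow> 'm"
  where "lie_deriv x \<phi> [] = act x (\<phi> [])"
  | "lie_deriv x \<phi> (z # zs) = lie_deriv x (contract z \<phi>) zs + \<phi> (bracket x z # zs)"

text \<open>Cartan's formula, evaluated at the head of the list. A differential raises the degree by
  one, hence the value 0 on the empty list.\<close>

primrec cartan_diff :: "('l list \<Rightarrow> 'm) \<Rightarrow> 'l list \<Rightarrow> 'm"
  where "cartan_diff \<phi> [] = 0"
  | "cartan_diff \<phi> (x # xs) = lie_deriv x \<phi> xs + cartan_diff (contract x \<phi>) xs"

definition cochain_mult :: "'f \<Rightarrow> ('l list \<Rightarrow> 'm) \<Rightarrow> 'l list \<Rightarrow> 'm"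
  where "cochain_mult a \<phi> = (\<lambda>xs. scaleM a (\<phi> xs))"

lemma cochain_mult_apply [simp]: "cochain_mult a \<phi> xs = scaleM a (\<phi> xs)"
  by (simp add: cochain_mult_def)

lemma cochain_mult_0: "cochain_mult 0 \<phi> = 0"
  by (simp add: fun_eq_iff)

lemma contract_apply [simp]: "contract x \<phi> xs = \<phi> (x # xs)"
  by (simp add: contract_def)

lemma contract_plus: "contract x (\<phi> + \<psi>) = contract x \<phi> + contract x \<psi>"
  by (simp add: fun_eq_iff)

lemma contract_mult: "contract x (cochain_mult a \<phi>) = cochain_mult a (contract x \<phi>)"
  by (simp add: fun_eq_iff)

lemma contract_lie_deriv:
  "contract z (lie_deriv x \<phi>) = lie_deriv x (contract z \<phi>) + contract (bracket x z) \<phi>"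
  by (simp add: fun_eq_iff)

lemma contract_cartan_diff:
  "contract x (cartan_diff \<phi>) = lie_deriv x \<phi> + cartan_diff (contract x \<phi>)"
  by (simp add: fun_eq_iff)

lemma lie_deriv_plus: "lie_deriv x (\<phi> + \<psi>) = lie_deriv x \<phi> + lie_deriv x \<psi>"
proof
  show "lie_deriv x (\<phi> + \<psi>) zs = (lie_deriv x \<phi> + lie_deriv x \<psi>) zs" for zs
    by (induction zs arbitrary: \<phi> \<psi>) (simp_all add: act_add_right contract_plus add_ac)
qed

lemma lie_deriv_mult: "lie_deriv x (cochain_mult a \<phi>) = cochain_mult a (lie_deriv x \<phi>)"
proof
  show "lie_deriv x (cochain_mult a \<phi>) zs = cochain_mult a (lie_deriv x \<phi>) zs" for zs
    by (induction zs arbitrary: \<phi>)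
      (simp_all add: act_scale_right contract_mult M.scale_right_distrib)
qed

lemma lie_deriv_zero: "lie_deriv x 0 = 0"
  using lie_deriv_mult[of x 0 0] by (simp add: cochain_mult_0)

lemma cartan_diff_plus: "cartan_diff (\<phi> + \<psi>) = cartan_diff \<phi> + cartan_diff \<psi>"
proof
  show "cartan_diff (\<phi> + \<psi>) zs = (cartan_diff \<phi> + cartan_diff \<psi>) zs" for zs
    by (induction zs arbitrary: \<phi> \<psi>) (simp_all add: lie_deriv_plus contract_plus add_ac)
qed

lemma cartan_diff_mult: "cartan_diff (cochain_mult a \<phi>) = cochain_mult a (cartan_diff \<phi>)"
proof
  show "cartan_diff (cochain_mult a \<phi>) zs = cochain_mult a (cartan_diff \<phi>) zs" for zs
    by (induction zs arbitrary: \<phi>)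
      (simp_all add: lie_deriv_mult contract_mult M.scale_right_distrib)
qed

lemma cartan_diff_zero: "cartan_diff 0 = 0"
  using cartan_diff_mult[of 0 0] by (simp add: cochain_mult_0)

section \<open>Alternating multilinear cochains\<close>

abbreviation "CE \<equiv> CE_cochains scaleL scaleM"

lemma CE_length: "\<phi> \<in> CE n \<Longrightarrow> length xs \<noteq> n \<Longrightarrow> \<phi> xs = 0"
  by (simp add: CE_cochains_def)

lemma CE_linear:
  "\<phi> \<in> CE n \<Longrightarrow> length xs = n \<Longrightarrow> i < n \<Longrightarrow>
    Vector_Spaces.linear scaleL scaleM (\<lambda>x. \<phi> (xs[i := x]))"
  by (simp add: CE_cochains_def)

lemma CE_repeat:
  "\<phi> \<in> CE n \<Longrightarrow> length xs = n \<Longrightarrow> i < j \<Longrightarrow> j < n \<Longrightarrow> xs ! i = xs ! j \<Longrightarrow> \<phi> xs = 0"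
  by (simp add: CE_cochains_def)

lemma CE_zero: "0 \<in> CE n"
  by (simp add: CE_cochains_def linear_iff_add_scale)

lemma CE_plus: "\<phi> \<in> CE n \<Longrightarrow> \<psi> \<in> CE n \<Longrightarrow> \<phi> + \<psi> \<in> CE n"
  unfolding CE_cochains_def linear_iff_add_scale
  by (simp add: M.scale_right_distrib add_ac)

lemma CE_mult: "\<phi> \<in> CE n \<Longrightarrow> cochain_mult a \<phi> \<in> CE n"
  unfolding CE_cochains_def linear_iff_add_scale
  by (simp add: M.scale_right_distrib mult.commute)

text \<open>On lists of the wrong length all terms vanish, so the rule rewrites without a length
  condition.\<close>

lemma CE_add_left:
  assumes "\<phi> \<in> CE n" shows "\<phi> ((x + y) # zs) = \<phi> (x # zs) + \<phi> (y # zs)"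
proof (cases "length zs = n - 1 \<and> n > 0")
  case True
  with CE_linear[OF assms, of "x # zs" 0] show ?thesis by (simp add: linear_iff_add_scale)
qed (use assms in \<open>auto simp: CE_length\<close>)

lemma CE_scale_left:
  assumes "\<phi> \<in> CE n" shows "\<phi> (scaleL a x # zs) = scaleM a (\<phi> (x # zs))"
proof (cases "length zs = n - 1 \<and> n > 0")
  case True
  with CE_linear[OF assms, of "x # zs" 0] show ?thesis by (simp add: linear_iff_add_scale)
qed (use assms in \<open>auto simp: CE_length\<close>)

lemma CE_zero_left:
  assumes "\<phi> \<in> CE n" shows "\<phi> (0 # zs) = 0"
  using CE_scale_left[OF assms, of 0 0] by simp

lemma CE_repeat_left:
  assumes "\<phi> \<in> CE n" shows "\<phi> (x # x # zs) = 0"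
proof (cases "length (x # x # zs) = n")
  case True
  with CE_repeat[OF assms True, of 0 1] show ?thesis by simp
qed (use assms in \<open>rule CE_length\<close>)

lemma contract_CE_Suc:
  assumes "\<phi> \<in> CE (Suc n)" shows "contract x \<phi> \<in> CE n"
  unfolding CE_cochains_def
proof (safe, goal_cases)
  case (1 xs)
  then show ?case using assms by (simp add: CE_length)
next
  case (2 xs i)
  then show ?case using CE_linear[OF assms, of "x # xs" "Suc i"] by simp
next
  case (3 xs i j)
  then show ?case using CE_repeat[OF assms, of "x # xs" "Suc i" "Suc j"] by simp
qed

lemma contract_CE_0:
  assumes "\<phi> \<in> CE 0" shows "contract x \<phi> = 0"
  using assms by (simp add: fun_eq_iff CE_length)

text \<open>For \<open>n = 0\<close> the contraction is zero and \<open>n - 1\<close> is 0, so the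
  rule covers every degree; inductions on the argument list apply it with \<open>n\<close>
  arbitrary.\<close>

lemma contract_CE: "\<phi> \<in> CE n \<Longrightarrow> contract x \<phi> \<in> CE (n - 1)"
  by (cases n) (auto simp: contract_CE_0 CE_zero contract_CE_Suc)

lemma CE_0_iff: "\<phi> \<in> CE 0 \<longleftrightarrow> (\<forall>x. contract x \<phi> = 0)"
proof -
  have "(\<forall>xs. xs \<noteq> [] \<longrightarrow> \<phi> xs = 0) \<longleftrightarrow> (\<forall>x xs. \<phi> (x # xs) = 0)"
    by (metis list.exhaust list.distinct(1))
  then show ?thesis by (simp add: CE_cochains_def fun_eq_iff)
qed

text \<open>Once all contractions are alternating, only repetitions that involve the head are left.
  If the repeated entry is not the second one, swapping the first two entries moves the repetition
  into a contraction.\<close>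

lemma CE_SucI:
  assumes Nil: "\<phi> [] = 0" and contract: "\<And>x. contract x \<phi> \<in> CE n"
    and add: "\<And>x y zs. \<phi> ((x + y) # zs) = \<phi> (x # zs) + \<phi> (y # zs)"
    and scale: "\<And>a x zs. \<phi> (scaleL a x # zs) = scaleM a (\<phi> (x # zs))"
    and rep: "\<And>x zs. \<phi> (x # x # zs) = 0"
  shows "\<phi> \<in> CE (Suc n)"
  unfolding CE_cochains_def
proof (safe, goal_cases)
  case (1 xs)
  then show ?case using Nil CE_length[OF contract] by (cases xs) auto
next
  case (2 xs i)
  then obtain z zs where [simp]: "xs = z # zs" by (cases xs) auto
  show ?case
  proof (cases i)
    case 0
    then show ?thesis by (simp add: linear_iff_add_scale add scale)
  next
    case (Suc k)
    with 2 CE_linear[OF contract, of zs k z] show ?thesis by simp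
  qed
next
  case (3 xs i j)
  then obtain z zs where xs: "xs = z # zs" by (cases xs) auto
  from 3 obtain l where j: "j = Suc l" by (cases j) auto
  show ?case
  proof (cases i)
    case (Suc k)
    with 3 xs j CE_repeat[OF contract, of zs k l z] show ?thesis by simp
  next
    case 0
    from 3 xs j obtain y ys where zs: "zs = y # ys" by (cases zs) auto
    show ?thesis
    proof (cases l)
      case l: 0
      then show ?thesis using 3 xs zs j 0 by (simp add: rep)
    next
      case l: (Suc l')
      have add2: "\<phi> (u # (v + w) # ys) = \<phi> (u # v # ys) + \<phi> (u # w # ys)" for u v w
        using CE_add_left[OF contract] by simp
      \<comment> \<open>Polarisation: expand the value with \<open>z + y\<close> in both leading
        places.\<close>
      have "\<phi> (z # y # ys) + \<phi> (y # z # ys) = 0"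
      proof -
        have "\<phi> ((z + y) # (z + y) # ys) =
            \<phi> (z # z # ys) + \<phi> (z # y # ys) + \<phi> (y # z # ys) +
            \<phi> (y # y # ys)"
          by (simp only: add add2 add_ac)
        then show ?thesis by (simp add: rep)
      qed
      \<comment> \<open>The entry \<open>z\<close> occurs again in \<open>ys\<close>, so the
        contraction with \<open>y\<close> meets a repetition.\<close>
      moreover have "\<phi> (y # z # ys) = 0"
        using 3 xs zs j 0 l CE_repeat[OF contract, of "z # ys" 0 l y] by simp
      ultimately show ?thesis by (simp add: xs zs)
    qed
  qed
qed

lemma lie_deriv_add_left:
  "\<phi> \<in> CE n \<Longrightarrow> lie_deriv (x + y) \<phi> zs = lie_deriv x \<phi> zs + lie_deriv y \<phi> zs"
proof (induction zs arbitrary: \<phi> n)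
  case (Cons z zs)
  have "lie_deriv (x + y) (contract z \<phi>) zs =
      lie_deriv x (contract z \<phi>) zs + lie_deriv y (contract z \<phi>) zs"
    by (rule Cons.IH[OF contract_CE[OF Cons.prems]])
  then show ?case
    by (simp add: bracket_add_left CE_add_left[OF Cons.prems] add_ac)
qed (simp add: act_add_left)

lemma lie_deriv_scale_left:
  "\<phi> \<in> CE n \<Longrightarrow> lie_deriv (scaleL a x) \<phi> zs = scaleM a (lie_deriv x \<phi> zs)"
proof (induction zs arbitrary: \<phi> n)
  case (Cons z zs)
  have "lie_deriv (scaleL a x) (contract z \<phi>) zs = scaleM a (lie_deriv x (contract z \<phi>) zs)"
    by (rule Cons.IH[OF contract_CE[OF Cons.prems]])
  then show ?case
    by (simp add: bracket_scale_left CE_scale_left[OF Cons.prems] M.scale_right_distrib)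
qed (simp add: act_scale_left)

end

section \<open>Identities special to characteristic 2\<close>

context restricted_module_char2
begin

lemma M_double: "m + m = (0::'m)"
proof -
  have "(1 + 1 :: 'f) = 0"
    using of_nat_CHAR[where 'a = 'f] by (simp add: char_2)
  then have "scaleM (1 + 1) m = 0" by simp
  then show ?thesis by (simp only: M.scale_left_distrib M.scale_one)
qed

lemma L_double: "x + x = (0::'l)"
proof -
  have "(1 + 1 :: 'f) = 0"
    using of_nat_CHAR[where 'a = 'f] by (simp add: char_2)
  then have "scaleL (1 + 1) x = 0" by simp
  then show ?thesis by (simp only: scale_left_distrib scale_one)
qed

lemma M_double_left: "m + (m + n) = (n::'m)"
  by (simp add: M_double flip: add.assoc)

lemma M_eq_iff: "m = n \<longleftrightarrow> m + n = (0::'m)"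
  by (metis M_double M_double_left add_0_right)

lemma L_eq_iff: "x = y \<longleftrightarrow> x + y = (0::'l)"
  by (metis L_double add_right_cancel)

text \<open>Normalises sums in the module: sorting brings equal terms together, and they cancel in
  pairs, also inside a longer sum.\<close>

lemmas M_simps = add_ac M_double M_double_left

text \<open>Polarising \<open>bracket x x = 0\<close> gives antisymmetry, and signs do not matter
  here.\<close>

lemma bracket_commute: "bracket x y = bracket y x"
proof -
  have "bracket (x + y) (x + y) = bracket x x + bracket x y + bracket y x + bracket y y"
    by (simp only: bracket_add_left bracket_add_right add_ac)
  then show ?thesis
    by (subst L_eq_iff) (simp add: bracket_self)
qed

lemma bracket_bracket:
  "bracket (bracket x y) z = bracket x (bracket y z) + bracket y (bracket x z)"
  using jacobi[of x y z]
  by (subst L_eq_iff) (simp add: bracket_commute[of z] add_ac)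

text \<open>This is \<open>ad (x^[2]) = (ad x)^2\<close>, with the bracket turned around by
  symmetry.\<close>

lemma bracket_sq_left: "bracket (sq x) z = bracket x (bracket x z)"
  by (metis bracket_commute bracket_sq)

lemma act_bracket2: "act (bracket x y) m = act x (act y m) + act y (act x m)"
  by (metis M_eq_iff act_bracket add.commute diff_add_cancel M_double_left)

lemma CE_swap:
  assumes "\<phi> \<in> CE n" shows "\<phi> (x # y # zs) = \<phi> (y # x # zs)"
proof -
  have add2: "\<phi> (u # (v + w) # zs) = \<phi> (u # v # zs) + \<phi> (u # w # zs)" for u v w
    using CE_add_left[OF contract_CE[OF assms]] by simp
  have "\<phi> ((x + y) # (x + y) # zs) =
      \<phi> (x # x # zs) + \<phi> (x # y # zs) + \<phi> (y # x # zs) + \<phi> (y # y # zs)"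
    by (simp only: CE_add_left[OF assms] add2 add_ac)
  then show ?thesis
    by (subst M_eq_iff) (simp add: CE_repeat_left[OF assms])
qed

lemma contract_contract_self: "\<phi> \<in> CE n \<Longrightarrow> contract x (contract x \<phi>) = 0"
  by (simp add: fun_eq_iff CE_repeat_left)

section \<open>Lie derivative and differential preserve alternating cochains\<close>

lemma lie_deriv_CE: "\<phi> \<in> CE n \<Longrightarrow> lie_deriv x \<phi> \<in> CE n"
proof (induction n arbitrary: \<phi>)
  case 0
  then show ?case
    by (simp add: CE_0_iff contract_lie_deriv lie_deriv_zero)
next
  case (Suc n)
  note c = contract_CE_Suc[OF Suc.prems]
  have add: "contract (y + z) \<phi> = contract y \<phi> + contract z \<phi>" for y z
    by (simp add: fun_eq_iff CE_add_left[OF Suc.prems])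
  have scale: "contract (scaleL a y) \<phi> = cochain_mult a (contract y \<phi>)" for a y
    by (simp add: fun_eq_iff CE_scale_left[OF Suc.prems])
  show ?case
  proof (rule CE_SucI)
    show "lie_deriv x \<phi> [] = 0"
      using Suc.prems by (simp add: CE_length act_zero_right)
    show "contract z (lie_deriv x \<phi>) \<in> CE n" for z
      unfolding contract_lie_deriv by (intro CE_plus Suc.IH c)
    \<comment> \<open>Besides \<open>th_x i_z i_z \<phi> = 0\<close>, two terms remain, with leading
      entries \<open>z, [x,z]\<close> and \<open>[x,z], z\<close>; they are equal by
      \<open>CE_swap\<close>.\<close>
    show "lie_deriv x \<phi> (z # z # zs) = 0" for z zs
      by (simp add: contract_contract_self[OF Suc.prems] lie_deriv_zero
          CE_swap[OF Suc.prems, of z] M_double)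
  qed (simp_all add: add scale lie_deriv_plus lie_deriv_mult bracket_add_right
      bracket_scale_right CE_add_left[OF Suc.prems] CE_scale_left[OF Suc.prems]
      M.scale_right_distrib add_ac)
qed

lemma cartan_diff_CE: "\<phi> \<in> CE n \<Longrightarrow> cartan_diff \<phi> \<in> CE (Suc n)"
proof (induction n arbitrary: \<phi>)
  case 0
  show ?case
  proof (rule CE_SucI)
    show "contract x (cartan_diff \<phi>) \<in> CE 0" for x
      by (simp add: contract_cartan_diff contract_CE_0[OF 0] cartan_diff_zero lie_deriv_CE[OF 0])
  qed (simp_all add: contract_CE_0[OF 0] cartan_diff_zero lie_deriv_zero CE_length[OF 0]
      lie_deriv_add_left[OF 0] lie_deriv_scale_left[OF 0])
next
  case (Suc n)
  note c = contract_CE_Suc[OF Suc.prems]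
  have add: "contract (y + z) \<phi> = contract y \<phi> + contract z \<phi>" for y z
    by (simp add: fun_eq_iff CE_add_left[OF Suc.prems])
  have scale: "contract (scaleL a y) \<phi> = cochain_mult a (contract y \<phi>)" for a y
    by (simp add: fun_eq_iff CE_scale_left[OF Suc.prems])
  show ?case
  proof (rule CE_SucI)
    show "contract x (cartan_diff \<phi>) \<in> CE (Suc n)" for x
      unfolding contract_cartan_diff by (intro CE_plus Suc.IH c lie_deriv_CE Suc.prems)
    \<comment> \<open>Cartan's formula applied twice produces \<open>th_x i_x \<phi>\<close> twice,
      a term with \<open>[x,x] = 0\<close>, and \<open>d i_x i_x \<phi> = 0\<close>.\<close>
    show "cartan_diff \<phi> (x # x # zs) = 0" for x zs
      by (simp add: contract_contract_self[OF Suc.prems] cartan_diff_zero bracket_self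
          CE_zero_left[OF Suc.prems] M_double)
  qed (simp_all add: add scale cartan_diff_plus cartan_diff_mult
      lie_deriv_add_left[OF Suc.prems] lie_deriv_scale_left[OF Suc.prems]
      M.scale_right_distrib add_ac)
qed

section \<open>Commutation relations of the Cartan calculus\<close>

lemma lie_deriv_commutator:
  "\<phi> \<in> CE n \<Longrightarrow>
    lie_deriv (bracket x y) \<phi> = lie_deriv x (lie_deriv y \<phi>) + lie_deriv y (lie_deriv x \<phi>)"
proof
  show "lie_deriv (bracket x y) \<phi> zs =
      (lie_deriv x (lie_deriv y \<phi>) + lie_deriv y (lie_deriv x \<phi>)) zs" if "\<phi> \<in> CE n" for zs
    using that
  proof (induction zs arbitrary: \<phi> n)
    case (Cons z zs)
    have "lie_deriv (bracket x y) (contract z \<phi>) zs =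
        (lie_deriv x (lie_deriv y (contract z \<phi>)) + lie_deriv y (lie_deriv x (contract z \<phi>))) zs"
      by (rule Cons.IH[OF contract_CE[OF Cons.prems]])
    \<comment> \<open>Moving \<open>i_z\<close> inwards creates \<open>th_x i_[y,z] \<phi>\<close>
      and \<open>th_y i_[x,z] \<phi>\<close>, each twice; the double brackets match by
      Jacobi.\<close>
    then show ?case
      by (simp add: contract_lie_deriv lie_deriv_plus bracket_bracket
          CE_add_left[OF Cons.prems] M_simps)
  qed (simp add: act_bracket2)
qed

text \<open>Here the restricted structure enters: \<open>act_sq\<close> is the case of the empty
  list, and \<open>bracket_sq\<close> settles the remaining term \<open>i_[x,[x,z]] \<phi>\<close>,
  since \<open>th_x i_[x,z] \<phi>\<close> occurs twice.\<close>

lemma lie_deriv_sq: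
  "\<phi> \<in> CE n \<Longrightarrow> lie_deriv (sq x) \<phi> = lie_deriv x (lie_deriv x \<phi>)"
proof
  show "lie_deriv (sq x) \<phi> zs = lie_deriv x (lie_deriv x \<phi>) zs" if "\<phi> \<in> CE n" for zs
    using that
  proof (induction zs arbitrary: \<phi> n)
    case (Cons z zs)
    have "lie_deriv (sq x) (contract z \<phi>) zs = lie_deriv x (lie_deriv x (contract z \<phi>)) zs"
      by (rule Cons.IH[OF contract_CE[OF Cons.prems]])
    then show ?case
      by (simp add: contract_lie_deriv lie_deriv_plus bracket_sq_left M_simps)
  qed (simp add: act_sq)
qed

text \<open>After contraction with \<open>z\<close>, the sides differ by
  \<open>th_z th_x + th_x th_z + th_[x,z]\<close> applied to \<open>\<phi>\<close>, up to the
  induction hypothesis.\<close>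

lemma cartan_diff_lie_deriv:
  "\<phi> \<in> CE n \<Longrightarrow> cartan_diff (lie_deriv x \<phi>) = lie_deriv x (cartan_diff \<phi>)"
proof
  show "cartan_diff (lie_deriv x \<phi>) zs = lie_deriv x (cartan_diff \<phi>) zs" if "\<phi> \<in> CE n" for zs
    using that
  proof (induction zs arbitrary: \<phi> n)
    case (Cons z zs)
    have "cartan_diff (lie_deriv x (contract z \<phi>)) zs = lie_deriv x (cartan_diff (contract z \<phi>)) zs"
      by (rule Cons.IH[OF contract_CE[OF Cons.prems]])
    then show ?case
      by (simp add: contract_lie_deriv contract_cartan_diff lie_deriv_plus cartan_diff_plus
          lie_deriv_commutator[OF Cons.prems] M_simps)
  qed (simp add: act_zero_right)
qed

text \<open>By Cartan's formula \<open>i_z d d = th_z d + d th_z + d d i_z\<close>; the first two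
  terms cancel and the last is the induction hypothesis.\<close>

lemma cartan_diff_cartan_diff:
  "\<phi> \<in> CE n \<Longrightarrow> cartan_diff (cartan_diff \<phi>) = 0"
proof
  show "cartan_diff (cartan_diff \<phi>) zs = 0 zs" if "\<phi> \<in> CE n" for zs
    using that
  proof (induction zs arbitrary: \<phi> n)
    case (Cons z zs)
    have "cartan_diff (cartan_diff (contract z \<phi>)) zs = 0 zs"
      by (rule Cons.IH[OF contract_CE[OF Cons.prems]])
    then show ?case
      by (simp add: contract_cartan_diff cartan_diff_plus
          cartan_diff_lie_deriv[OF Cons.prems] M_simps)
  qed simp
qed

section \<open>Agreement with the explicit Chevalley-Eilenberg formula\<close>

lemma lie_deriv_eq_sum:
  "\<phi> \<in> CE n \<Longrightarrow> lie_deriv x \<phi> zs =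
    act x (\<phi> zs) + (\<Sum>i<length zs. \<phi> (bracket x (zs ! i) # nths zs (- {i})))"
proof (induction zs arbitrary: \<phi> n)
  case (Cons z zs)
  have "lie_deriv x (contract z \<phi>) zs = act x (contract z \<phi> zs) +
      (\<Sum>i<length zs. contract z \<phi> (bracket x (zs ! i) # nths zs (- {i})))"
    by (rule Cons.IH[OF contract_CE[OF Cons.prems]])
  \<comment> \<open>The recursion leaves the bracket behind \<open>z\<close>, the sum has it in
    front; one swap reconciles them. Index 0, the head of the list, is split off from the
    sum.\<close>
  then show ?case
    by (simp add: sum.lessThan_Suc_shift nths_Cons_omit CE_swap[OF Cons.prems, of z] add_ac
        del: sum.lessThan_Suc)
qed simp

text \<open>For a list with head \<open>x\<close>, the terms that act by \<open>x\<close> or bracket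
  with \<open>x\<close> make up \<open>lie_deriv x \<phi> xs\<close>; the others belong to
  \<open>contract x \<phi>\<close>.\<close>

lemma cartan_diff_eq_sum:
  "\<phi> \<in> CE n \<Longrightarrow> cartan_diff \<phi> xs =
    (\<Sum>j<length xs. \<Sum>i<j. \<phi> (bracket (xs ! i) (xs ! j) # nths xs (- {i, j}))) +
    (\<Sum>i<length xs. act (xs ! i) (\<phi> (nths xs (- {i}))))"
proof (induction xs arbitrary: \<phi> n)
  case (Cons x xs)
  have "cartan_diff (contract x \<phi>) xs =
    (\<Sum>j<length xs. \<Sum>i<j. contract x \<phi> (bracket (xs ! i) (xs ! j) # nths xs (- {i, j}))) +
    (\<Sum>i<length xs. act (xs ! i) (contract x \<phi> (nths xs (- {i}))))"
    by (rule Cons.IH[OF contract_CE[OF Cons.prems]])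
  then show ?case
    by (simp add: sum.lessThan_Suc_shift nths_Cons_omit CE_swap[OF Cons.prems, of x] add_ac
        lie_deriv_eq_sum[OF Cons.prems] sum.distrib del: sum.lessThan_Suc)
qed simp

lemma CE_diff_eq_cartan_diff:
  assumes "\<phi> \<in> CE n" shows "CE_diff bracket act n \<phi> = cartan_diff \<phi>"
proof
  fix xs
  show "CE_diff bracket act n \<phi> xs = cartan_diff \<phi> xs"
  proof (cases "length xs = Suc n")
    case True
    then show ?thesis
      by (simp add: CE_diff_def cartan_diff_eq_sum[OF assms] del: sum.lessThan_Suc)
  next
    case False
    then show ?thesis
      using CE_length[OF cartan_diff_CE[OF assms]] by (simp add: CE_diff_def)
  qed
qed

section \<open>Restricted cochains and their differential\<close>

abbreviation "C2 \<equiv> star2_cochains scaleL scaleM"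

text \<open>The laws of the second component as equations of functions, uniform in the degree. Below
  degree 2 they hold because \<open>snd c\<close> is 0 and \<open>fst c\<close> vanishes on lists
  with two or more entries.\<close>

lemma star2_cochainsD:
  assumes "c \<in> C2 n"
  shows "fst c \<in> CE n" "snd c x \<in> CE (n - 2)" "n < 2 \<Longrightarrow> snd c = 0"
    "snd c (scaleL a x) = cochain_mult (a\<^sup>2) (snd c x)"
    "snd c (x + y) = snd c x + snd c y + contract y (contract x (fst c))"
proof -
  show c: "fst c \<in> CE n" "snd c x \<in> CE (n - 2)" for x
    using assms by (auto simp: star2_cochains_def CE_zero split: if_splits)
  show "n < 2 \<Longrightarrow> snd c = 0"
    using assms by (auto simp: star2_cochains_def)
  show "snd c (scaleL a x) = cochain_mult (a\<^sup>2) (snd c x)"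
  proof
    show "snd c (scaleL a x) zs = cochain_mult (a\<^sup>2) (snd c x) zs" for zs
      using assms CE_length[OF c(2), of zs]
      by (cases "length zs = n - 2") (auto simp: star2_cochains_def split: if_splits)
  qed
  show "snd c (x + y) = snd c x + snd c y + contract y (contract x (fst c))"
  proof
    show "snd c (x + y) zs = (snd c x + snd c y + contract y (contract x (fst c))) zs" for zs
      using assms CE_length[OF c(2), of zs] CE_length[OF c(1), of "x # y # zs"]
      by (cases "length zs = n - 2") (auto simp: star2_cochains_def split: if_splits)
  qed
qed

lemma star2_cochainsI:
  assumes "fst c \<in> CE n" "\<And>x. snd c x \<in> CE (n - 2)" "n < 2 \<Longrightarrow> snd c = 0"
    and "\<And>a x. snd c (scaleL a x) = cochain_mult (a\<^sup>2) (snd c x)"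
    and "\<And>x y. snd c (x + y) = snd c x + snd c y + contract y (contract x (fst c))"
  shows "c \<in> C2 n"
  using assms by (cases c) (auto simp: star2_cochains_def)

text \<open>A description of the differential that does not mention the degree: the vanishing of
  cochains on lists of the wrong length accounts for the case distinctions.\<close>

definition cartan_diff2 :: "('l, 'm) cochain \<Rightarrow> ('l, 'm) cochain"
  where "cartan_diff2 c = (cartan_diff (fst c),
    \<lambda>x. lie_deriv x (contract x (fst c)) + contract (sq x) (fst c) + cartan_diff (snd c x))"

text \<open>\<open>Suc (n - 2)\<close> equals \<open>n - 1\<close> only from degree 2 on; below that
  the second component is 0.\<close>

lemma cartan_diff_snd_CE:
  assumes "c \<in> C2 n" shows "cartan_diff (snd c x) \<in> CE (n - 1)"
proof (cases "n < 2")
  case True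
  then show ?thesis
    using star2_cochainsD(3)[OF assms] by (simp add: cartan_diff_zero CE_zero)
next
  case False
  then have "Suc (n - 2) = n - 1" by simp
  then show ?thesis
    using cartan_diff_CE[OF star2_cochainsD(2)[OF assms]] by metis
qed

lemma snd_cartan_diff2_CE:
  assumes "c \<in> C2 n" shows "snd (cartan_diff2 c) x \<in> CE (n - 1)"
  using assms unfolding cartan_diff2_def snd_conv
  by (intro CE_plus lie_deriv_CE contract_CE cartan_diff_snd_CE star2_cochainsD(1))

text \<open>Of the five terms of \<open>star2_delta\<close>, the first and fourth form
  \<open>th_x i_x \<phi>\<close>, the third is the contraction with \<open>sq x\<close>, and the
  second and fifth form \<open>d (\<omega> x)\<close>. The fourth needs a swap of \<open>x\<close>
  and the bracket.\<close>

lemma star2_delta_eq: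
  assumes "c \<in> C2 n" "n \<ge> 2"
  shows "star2_delta bracket sq act n c = snd (cartan_diff2 c)"
proof (intro ext)
  fix x zs
  obtain \<phi> \<omega> where c: "c = (\<phi>, \<omega>)" by (cases c)
  show "star2_delta bracket sq act n c x zs = snd (cartan_diff2 c) x zs"
  proof (cases "length zs = n - 1")
    case True
    have \<phi>: "\<phi> \<in> CE n" and \<omega>: "\<omega> x \<in> CE (n - 2)"
      using star2_cochainsD(1,2)[OF assms(1)] by (auto simp: c)
    show ?thesis
      using True
      by (simp add: star2_delta_def cartan_diff2_def c cartan_diff_eq_sum[OF \<omega>]
          lie_deriv_eq_sum[OF contract_CE[OF \<phi>]] CE_swap[OF \<phi>, of x] add_ac)
  next
    case False
    then show ?thesis
      using CE_length[OF snd_cartan_diff2_CE[OF assms(1)]] by (simp add: star2_delta_def c)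
  qed
qed

lemma star2_diff_eq:
  assumes "c \<in> C2 n" shows "star2_diff bracket sq act n c = cartan_diff2 c"
proof -
  note \<phi> = star2_cochainsD(1)[OF assms]
  have "snd (star2_diff bracket sq act n c) = snd (cartan_diff2 c)"
  proof (cases "n < 2")
    case False
    then show ?thesis using star2_delta_eq[OF assms] by (simp add: star2_diff_def)
  next
    case True
    have \<omega>: "snd c = 0" using star2_cochainsD(3)[OF assms True] .
    show ?thesis
    proof (cases "n = 0")
      case True
      moreover have "cartan_diff (snd c x) = 0" for x
        by (simp add: \<omega> cartan_diff_zero)
      ultimately show ?thesis
        using \<phi> by (simp add: star2_diff_def cartan_diff2_def fun_eq_iff contract_CE_0
            lie_deriv_zero CE_length)
    next
      case False
      with True have n: "n = 1" by simp
      \<comment> \<open>In degree 1 this component lies in \<open>CE 0\<close>, so only the empty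
        list counts; there the formula for \<open>d^1\<close> appears by evaluation.\<close>
      have "snd (cartan_diff2 c) x zs = 0" if "zs \<noteq> []" for x zs
        using CE_length[OF snd_cartan_diff2_CE[OF assms]] that n by simp
      then show ?thesis
        by (auto simp: star2_diff_def n fun_eq_iff)
          (simp add: cartan_diff2_def add.commute)
    qed
  qed
  then show ?thesis
    by (simp add: prod_eq_iff star2_diff_def cartan_diff2_def CE_diff_eq_cartan_diff[OF \<phi>])
qed

lemma cartan_diff2_cochain:
  assumes "c \<in> C2 n" shows "cartan_diff2 c \<in> C2 (Suc n)"
proof (rule star2_cochainsI)
  note \<phi> = star2_cochainsD(1)[OF assms] and \<omega> = star2_cochainsD(4,5)[OF assms]
  have add: "contract (x + y) (fst c) = contract x (fst c) + contract y (fst c)" for x y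
    by (simp add: fun_eq_iff CE_add_left[OF \<phi>])
  have scale: "contract (scaleL a x) (fst c) = cochain_mult a (contract x (fst c))" for a x
    by (simp add: fun_eq_iff CE_scale_left[OF \<phi>])
  note lie = lie_deriv_add_left[OF contract_CE[OF \<phi>]] lie_deriv_scale_left[OF contract_CE[OF \<phi>]]
  show "fst (cartan_diff2 c) \<in> CE (Suc n)"
    by (simp add: cartan_diff2_def cartan_diff_CE[OF \<phi>])
  show "snd (cartan_diff2 c) x \<in> CE (Suc n - 2)" for x
    using snd_cartan_diff2_CE[OF assms] by simp
  \<comment> \<open>Each of the three summands is quadratic in \<open>x\<close>; in
    \<open>th_x i_x\<close> both occurrences of \<open>x\<close> contribute a factor
    \<open>a\<close>.\<close>
  show "snd (cartan_diff2 c) (scaleL a x) = cochain_mult (a\<^sup>2) (snd (cartan_diff2 c) x)" for a x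
    by (simp add: fun_eq_iff cartan_diff2_def scale \<omega> lie_deriv_mult cartan_diff_mult lie
        sq_scale CE_scale_left[OF \<phi>] M.scale_right_distrib power2_eq_square)
  \<comment> \<open>The cross terms are \<open>th_x i_y \<phi> + th_y i_x \<phi>\<close>, then
    \<open>i_[x,y] \<phi>\<close> from \<open>sq_add\<close>, and \<open>d i_y i_x \<phi>\<close>
    from the law for \<open>\<omega>\<close>. Their sum is \<open>i_y i_x d \<phi>\<close> by
    Cartan's formula.\<close>
  show "snd (cartan_diff2 c) (x + y) = snd (cartan_diff2 c) x + snd (cartan_diff2 c) y +
      contract y (contract x (fst (cartan_diff2 c)))" for x y
    by (simp add: fun_eq_iff cartan_diff2_def add \<omega> lie_deriv_plus cartan_diff_plus lie
        sq_add CE_add_left[OF \<phi>] add_ac)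
  \<comment> \<open>Only degree 0 is meant, where \<open>star2_diff\<close> has second component 0
    by definition.\<close>
  show "snd (cartan_diff2 c) = 0" if "Suc n < 2"
  proof -
    from that assms have "c \<in> C2 0" by simp
    from star2_diff_eq[OF this] show ?thesis
      by (simp add: star2_diff_def prod_eq_iff)
  qed
qed

text \<open>In the second component \<open>d i_(x^[2]) \<phi>\<close> and
  \<open>d th_x i_x \<phi>\<close> occur twice, the latter once as \<open>th_x d i_x \<phi>\<close>;
  \<open>lie_deriv_sq\<close> removes the rest.\<close>

lemma cartan_diff2_cartan_diff2:
  assumes "c \<in> C2 n" shows "cartan_diff2 (cartan_diff2 c) = 0"
proof -
  note \<phi> = star2_cochainsD(1)[OF assms]
  show ?thesis
    by (simp add: prod_eq_iff fun_eq_iff cartan_diff2_def contract_cartan_diff lie_deriv_plus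
        cartan_diff_plus cartan_diff_cartan_diff[OF \<phi>] lie_deriv_sq[OF \<phi>]
        cartan_diff_cartan_diff[OF star2_cochainsD(2)[OF assms]]
        cartan_diff_lie_deriv[OF contract_CE[OF \<phi>]] M_simps)
qed

section \<open>Linear structure on cochains\<close>

lemma cochain_scale_eq:
  "cochain_scale scaleM a c = (cochain_mult a (fst c), \<lambda>x. cochain_mult a (snd c x))"
  by (simp add: cochain_scale_def cochain_mult_def)

text \<open>Linearity holds on the whole type of pairs, so the general facts on kernels and images
  of linear maps apply.\<close>

lemma cartan_diff2_linear:
  "Vector_Spaces.linear (cochain_scale scaleM) (cochain_scale scaleM) cartan_diff2"
proof -
  have V: "vector_space (cochain_scale scaleM :: _ \<Rightarrow> ('l, 'm) cochain \<Rightarrow> _)"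
    by (rule vector_space_cochain_scale) unfold_locales
  show ?thesis
    unfolding Vector_Spaces.linear_iff
    by (intro conjI V allI)
      (simp_all add: cochain_scale_eq cartan_diff2_def prod_eq_iff fun_eq_iff contract_plus
        contract_mult lie_deriv_plus lie_deriv_mult cartan_diff_plus cartan_diff_mult
        M.scale_right_distrib add_ac)
qed

lemma star2_cochains_subspace: "module.subspace (cochain_scale scaleM) (C2 n)"
proof -
  have V: "vector_space (cochain_scale scaleM :: _ \<Rightarrow> ('l, 'm) cochain \<Rightarrow> _)"
    by (rule vector_space_cochain_scale) unfold_locales
  interpret V: vector_space "cochain_scale scaleM :: _ \<Rightarrow> ('l, 'm) cochain \<Rightarrow> _"
    by (rule V)
  show ?thesis
    unfolding V.subspace_def
  proof (intro conjI ballI allI)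
    show "0 \<in> C2 n"
      by (rule star2_cochainsI) (auto simp: CE_zero fun_eq_iff)
  next
    fix c c' assume "c \<in> C2 n" "c' \<in> C2 n"
    note D = star2_cochainsD[OF this(1)] star2_cochainsD[OF this(2)]
    show "c + c' \<in> C2 n"
      by (rule star2_cochainsI)
        (auto simp: D CE_plus fun_eq_iff M.scale_right_distrib add_ac)
  next
    fix a c assume "c \<in> C2 n"
    note D = star2_cochainsD[OF this]
    show "cochain_scale scaleM a c \<in> C2 n"
      unfolding cochain_scale_eq
      by (rule star2_cochainsI)
        (auto simp: D CE_mult fun_eq_iff M.scale_right_distrib mult.commute)
  qed
qed

end

section \<open>Assembly of the cochain complex, cocycles and coboundaries\<close>

theorem theorem4p9:
  fixes scaleL :: "'f::field \<Rightarrow> 'l::ab_group_add \<Rightarrow> 'l"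
    and bracket :: "'l \<Rightarrow> 'l \<Rightarrow> 'l"
    and sq :: "'l \<Rightarrow> 'l"
    and scaleM :: "'f \<Rightarrow> 'm::ab_group_add \<Rightarrow> 'm"
    and act :: "'l \<Rightarrow> 'm \<Rightarrow> 'm"
  defines "C \<equiv> star2_cochains scaleL scaleM"
    and "d \<equiv> star2_diff bracket sq act"
    and "Z \<equiv> star2_cocycles scaleL bracket sq scaleM act"
    and "B \<equiv> star2_coboundaries scaleL bracket sq scaleM act"
  assumes "restricted_module_char2 scaleL bracket sq scaleM act"
  shows "(\<forall>n. module.subspace (cochain_scale scaleM) (C n)) \<and>
    (\<forall>n. d n \<in> C n \<rightarrow> C (Suc n)) \<and>
    (\<forall>n. \<forall>c\<in>C n. \<forall>c'\<in>C n. d n (c + c') = d n c + d n c') \<and>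
    (\<forall>n a. \<forall>c\<in>C n. d n (cochain_scale scaleM a c) = cochain_scale scaleM a (d n c)) \<and>
    (\<forall>n. \<forall>c\<in>C n. d (Suc n) (d n c) = 0) \<and>
    (\<forall>n. module.subspace (cochain_scale scaleM) (Z n) \<and>
         module.subspace (cochain_scale scaleM) (B n) \<and> B n \<subseteq> Z n)"
proof -
  interpret restricted_module_char2 scaleL bracket sq scaleM act by fact
  interpret T: Vector_Spaces.linear "cochain_scale scaleM" "cochain_scale scaleM" cartan_diff2
    by (rule cartan_diff2_linear)
  have C: "T.vs1.subspace (C n)" for n
    unfolding C_def by (rule star2_cochains_subspace)
  have d: "d n c = cartan_diff2 c" if "c \<in> C n" for n c
    using that star2_diff_eq unfolding C_def d_def by simp
  have mem: "d n c \<in> C (Suc n)" if "c \<in> C n" for n c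
    using cartan_diff2_cochain that unfolding d[OF that] C_def by simp
  have dd: "d (Suc n) (d n c) = 0" if "c \<in> C n" for n c
    using cartan_diff2_cartan_diff2 that d[OF mem[OF that]] d[OF that] unfolding C_def by simp
  \<comment> \<open>On cochains \<open>d n\<close> is the single map \<open>cartan_diff2\<close>, so
    cocycles are its kernel intersected with a subspace.\<close>
  have Z_eq: "Z n = C n \<inter> {c. cartan_diff2 c = 0}" for n
    using d unfolding Z_def star2_cocycles_def C_def[symmetric] d_def[symmetric] by auto
  have Z: "T.vs1.subspace (Z n)" for n
    unfolding Z_eq by (intro T.vs1.subspace_inter C T.subspace_kernel)
  have B_0: "B 0 = {0}"
    by (simp add: B_def star2_coboundaries_def)
  have B_Suc: "B (Suc n) = d n ` C n" for n
    by (simp add: B_def star2_coboundaries_def C_def d_def)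
  have B: "T.vs1.subspace (B n)" for n
  proof (cases n)
    case 0
    then show ?thesis by (simp add: B_0 T.vs1.subspace_single_0)
  next
    case (Suc k)
    have "d k ` C k = cartan_diff2 ` C k" by (simp add: d)
    then show ?thesis using T.subspace_image[OF C] by (simp add: Suc B_Suc)
  qed
  have BZ: "B n \<subseteq> Z n" for n
  proof (cases n)
    case 0
    then show ?thesis using T.vs1.subspace_0[OF Z] by (simp add: B_0)
  next
    case (Suc k)
    then show ?thesis
      using mem dd d by (auto simp: B_Suc Z_eq)
  qed
  have add: "d n (c + c') = d n c + d n c'" if "c \<in> C n" "c' \<in> C n" for n c c'
    using that by (simp add: d T.vs1.subspace_add[OF C] T.add)
  have scale: "d n (cochain_scale scaleM a c) = cochain_scale scaleM a (d n c)"
    if "c \<in> C n" for n a c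
    using that by (simp add: d T.vs1.subspace_scale[OF C] T.scale)
  show ?thesis
    using C Z B BZ mem dd add scale by blast
qed

end
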